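(* Let $\mathcal{C}$ be a subclass of the class of all Banach spaces over $\mathbb{K}$, let $F$ be a Banach space, and let $\mathfrak{P}$ be a property of bounded linear operators from spaces belonging to $\mathcal{C}$ to $F$. Suppose that, for every $E\in\mathcal{C}$, $\{u\in\mathcal{L}(E,F) : u\text{ has }\mathfrak{P}\}$ is a closed subspace of $\mathcal{L}(E,F)$. Then, for all $m\in\mathbb{N}$ and $E_1,\dots,E_m\in\mathcal{C}$, $$\{A\in\mathcal{L}(E_1,\dots,E_m;F) : A\text{ has }\mathfrak{P}\text{ separately}\}$$ is a closed subspace of $\mathcal{L}(E_1,\dots,E_m;F)$.
   Context: $\mathbb{K}=\mathbb{R}$ or $\mathbb{C}$. $\mathcal{L}(E_1,\dots,E_m;F)$ is the Banach space of continuous $m$-linear operators with the usual sup norm; $\mathcal{L}(E,F)$ carries the operator norm. An operator $A\in\mathcal{L}(E_1,\dots,E_m;F)$ has $\mathfrak{P}$ separately if for every $k=1,\dots,m$ and all fixed $a_i\in E_i$ ($i\ne k$), the bounded linear operator $E_k\to F$, $x_k\mapsto A(a_1,\dots,a_{k-1},x_k,a_{k+1},\dots,a_m)$, has property $\mathfrak{P}$. *)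

theory Defs
  imports "HOL-Analysis.Analysis" "HOL-Algebra.Module"
begin

text \<open>
  The \<open>m\<close> Banach spaces in the domain of a multilinear operator are pairwise unrelated, and
  \<open>m\<close> varies, so they cannot be modelled by \<open>m\<close> types.  Instead, a normed space is a
  carrier-based structure: a module in the sense of HOL-Algebra together with a norm.  The ring
  fields \<open>mult\<close> and \<open>one\<close>, which HOL-Algebra's module record inherits, play no role.

  The scalar field is a type \<open>'k\<close> of class \<open>real_normed_field\<close>.  Both \<open>real\<close> and \<open>complex\<close> are
  instances and, by the Gelfand-Mazur theorem (the norm of the class is multiplicative), they
  are the only ones up to isometric isomorphism.
\<close>

record ('k, 'a) normed = "('k, 'a) module" +
  vnorm :: "'a \<Rightarrow> real"

definition scalars :: "'k::real_normed_field ring" where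
  "scalars = \<lparr>carrier = UNIV, mult = (*), one = 1, zero = 0, add = (+)\<rparr>"

locale normed_space = Module.module scalars E
  for E :: "('k::real_normed_field, 'a) normed" (structure) +
  assumes vnorm_nonneg: "x \<in> carrier E \<Longrightarrow> 0 \<le> vnorm E x"
    and vnorm_eq_0_iff: "x \<in> carrier E \<Longrightarrow> vnorm E x = 0 \<longleftrightarrow> x = \<zero>"
    and vnorm_triangle: "x \<in> carrier E \<Longrightarrow> y \<in> carrier E \<Longrightarrow> vnorm E (x \<oplus> y) \<le> vnorm E x + vnorm E y"
    and vnorm_smult: "x \<in> carrier E \<Longrightarrow> vnorm E (c \<odot> x) = norm c * vnorm E x"

text \<open>
  \<open>Metric_space\<close> requires the distance to be nonnegative and symmetric on the whole type, hence the
  default value off the carrier.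
\<close>

definition vdist :: "('k::real_normed_field, 'a) normed \<Rightarrow> 'a \<Rightarrow> 'a \<Rightarrow> real" where
  "vdist E x y = (if x \<in> carrier E \<and> y \<in> carrier E then vnorm E (x \<ominus>\<^bsub>E\<^esub> y) else 0)"

lemma (in normed_space) Metric_space_vdist: "Metric_space (carrier E) (vdist E)"
proof
  fix x y
  show "0 \<le> vdist E x y"
    by (simp add: vdist_def vnorm_nonneg)
  show "vdist E x y = vdist E y x"
  proof (cases "x \<in> carrier E \<and> y \<in> carrier E")
    case True
    then have c: "x \<ominus> y \<in> carrier E" by simp
    have one: "\<one>\<^bsub>scalars\<^esub> = (1::'k)" "carrier scalars = (UNIV :: 'k set)"
      by (simp_all add: scalars_def)
    have "\<ominus>\<^bsub>scalars\<^esub> (1::'k) = -1"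
      by (rule R.minus_equality) (simp_all add: scalars_def)
    then have "(-1::'k) \<odot> (x \<ominus> y) = \<ominus> (x \<ominus> y)"
      using smult_l_minus[of 1 "x \<ominus> y"] smult_one[OF c] c one by simp
    also have "\<dots> = y \<ominus> x"
      using True by (simp add: a_minus_def M.minus_add M.a_comm)
    finally show ?thesis
      using vnorm_smult[OF c, of "-1"] True by (simp add: vdist_def)
  qed (auto simp: vdist_def)
  show "vdist E x y = 0 \<longleftrightarrow> x = y" if "x \<in> carrier E" "y \<in> carrier E"
  proof -
    have "x \<ominus> y = \<zero> \<longleftrightarrow> x = y"
      using that by (metis M.minus_equality M.minus_minus M.a_inv_closed M.r_neg a_minus_def)
    then show ?thesis
      using that by (simp add: vdist_def vnorm_eq_0_iff)
  qed
  show "vdist E x z \<le> vdist E x y + vdist E y z"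
    if "x \<in> carrier E" "y \<in> carrier E" "z \<in> carrier E" for z
  proof -
    have "x \<ominus> z = (x \<ominus> y) \<oplus> (y \<ominus> z)"
      using that by (simp add: a_minus_def M.a_assoc M.r_neg1)
    then show ?thesis
      using that vnorm_triangle[of "x \<ominus> y" "y \<ominus> z"] by (simp add: vdist_def)
  qed
qed

definition vtopology :: "('k::real_normed_field, 'a) normed \<Rightarrow> 'a topology" where
  "vtopology E = Metric_space.mtopology (carrier E) (vdist E)"

definition banach_space :: "('k::real_normed_field, 'a) normed \<Rightarrow> bool" where
  "banach_space E \<longleftrightarrow> normed_space E \<and> Metric_space.mcomplete (carrier E) (vdist E)"

definition closed_subspace :: "'a set \<Rightarrow> ('k::real_normed_field, 'a) normed \<Rightarrow> bool" where
  "closed_subspace S E \<longleftrightarrow> submodule S scalars E \<and> closedin (vtopology E) S"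

definition linear_op ::
  "('k::real_normed_field, 'a) normed \<Rightarrow> ('k, 'b) normed \<Rightarrow> ('a \<Rightarrow> 'b) \<Rightarrow> bool" where
  "linear_op E F u \<longleftrightarrow> u \<in> carrier E \<rightarrow> carrier F
     \<and> (\<forall>x\<in>carrier E. \<forall>y\<in>carrier E. u (x \<oplus>\<^bsub>E\<^esub> y) = u x \<oplus>\<^bsub>F\<^esub> u y)
     \<and> (\<forall>c. \<forall>x\<in>carrier E. u (c \<odot>\<^bsub>E\<^esub> x) = c \<odot>\<^bsub>F\<^esub> u x)"

text \<open>
  Operators are represented by functions that are \<open>undefined\<close> outside their domain, so that
  equality in HOL is equality of operators.
\<close>

definition op_space ::
  "'x set \<Rightarrow> ('x \<Rightarrow> 'b) set \<Rightarrow> (('x \<Rightarrow> 'b) \<Rightarrow> real) \<Rightarrow>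
    ('k::real_normed_field, 'b) normed \<Rightarrow> ('k, 'x \<Rightarrow> 'b) normed" where
  "op_space D L N F =
    \<lparr>carrier = L, mult = undefined, one = undefined,
     zero = (\<lambda>x\<in>D. \<zero>\<^bsub>F\<^esub>), add = (\<lambda>u v. \<lambda>x\<in>D. u x \<oplus>\<^bsub>F\<^esub> v x),
     smult = (\<lambda>c u. \<lambda>x\<in>D. c \<odot>\<^bsub>F\<^esub> u x), vnorm = N\<rparr>"

definition bounded_linear_ops ::
  "('k::real_normed_field, 'a) normed \<Rightarrow> ('k, 'b) normed \<Rightarrow> ('k, 'a \<Rightarrow> 'b) normed" where
  "bounded_linear_ops E F =
    op_space (carrier E)
      {u \<in> extensional (carrier E).
         linear_op E F u \<and> (\<exists>M. \<forall>x\<in>carrier E. vnorm F (u x) \<le> M * vnorm E x)}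
      (\<lambda>u. SUP x\<in>{x \<in> carrier E. vnorm E x \<le> 1}. vnorm F (u x))
      F"

text \<open>
  The tuple \<open>(x\<^sub>1, \<dots>, x\<^sub>m)\<close> is an element of the dependent product of the carriers over \<open>{1..m}\<close>.
  The value of \<open>a\<close> at \<open>k\<close> is irrelevant to \<open>slice E A a k\<close>.
\<close>

abbreviation tuples :: "nat \<Rightarrow> (nat \<Rightarrow> ('k::real_normed_field, 'a) normed) \<Rightarrow> (nat \<Rightarrow> 'a) set" where
  "tuples m E \<equiv> (\<Pi>\<^sub>E i\<in>{1..m}. carrier (E i))"

definition slice ::
  "(nat \<Rightarrow> ('k::real_normed_field, 'a) normed) \<Rightarrow> ((nat \<Rightarrow> 'a) \<Rightarrow> 'b) \<Rightarrow> (nat \<Rightarrow> 'a) \<Rightarrow> nat \<Rightarrow> 'a \<Rightarrow> 'b" where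
  "slice E A a k = (\<lambda>x\<in>carrier (E k). A (a(k := x)))"

definition multilinear_op ::
  "nat \<Rightarrow> (nat \<Rightarrow> ('k::real_normed_field, 'a) normed) \<Rightarrow> ('k, 'b) normed \<Rightarrow> ((nat \<Rightarrow> 'a) \<Rightarrow> 'b) \<Rightarrow> bool" where
  "multilinear_op m E F A \<longleftrightarrow>
    A \<in> tuples m E \<rightarrow> carrier F \<and>
    (\<forall>k\<in>{1..m}. \<forall>a\<in>tuples m E. linear_op (E k) F (slice E A a k))"

definition continuous_multilinear_ops ::
  "nat \<Rightarrow> (nat \<Rightarrow> ('k::real_normed_field, 'a) normed) \<Rightarrow> ('k, 'b) normed \<Rightarrow>
    ('k, (nat \<Rightarrow> 'a) \<Rightarrow> 'b) normed" where
  "continuous_multilinear_ops m E F =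
    op_space (tuples m E)
      {A \<in> extensional (tuples m E). multilinear_op m E F A \<and>
         continuous_map (product_topology (\<lambda>i. vtopology (E i)) {1..m}) (vtopology F) A}
      (\<lambda>A. SUP x\<in>{x \<in> tuples m E. \<forall>i\<in>{1..m}. vnorm (E i) (x i) \<le> 1}. vnorm F (A x))
      F"

text \<open>
  A property of operators into a fixed space is a predicate on a space and an operator defined
  on that space.
\<close>

definition has_separately ::
  "(('k::real_normed_field, 'a) normed \<Rightarrow> ('a \<Rightarrow> 'b) \<Rightarrow> bool) \<Rightarrow>
    nat \<Rightarrow> (nat \<Rightarrow> ('k, 'a) normed) \<Rightarrow> ((nat \<Rightarrow> 'a) \<Rightarrow> 'b) \<Rightarrow> bool" where
  "has_separately P m E A \<longleftrightarrow> (\<forall>k\<in>{1..m}. \<forall>a\<in>tuples m E. P (E k) (slice E A a k))"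

end

theory Submission
  imports Defs
begin

text \<open>
  For a position \<open>k\<close> and a tuple \<open>a\<close>, sending a multilinear operator \<open>A\<close> to its slice, the linear
  operator \<open>x \<mapsto> A (a(k := x))\<close>, is itself a linear map, from the space of continuous multilinear
  operators to the space of bounded linear operators on \<open>E k\<close>.  It is bounded: by
  multilinearity, the values of \<open>A\<close> on tuples whose entries have norm at most \<open>R\<close> have norm at most
  \<open>R ^ m\<close> times the sup norm of \<open>A\<close>, and an \<open>R\<close> can be chosen that works for all tuples \<open>a(k := x)\<close> with \<open>x\<close> in the unit
  ball (\<open>slice_vnorm_le\<close>).  Having the property separately
  means that every slice lies in the closed subspace given by the hypothesis
  for \<open>E k\<close>.  So the set in question is an intersection of preimages of closed subspaces under
  bounded linear maps, which is a closed subspace (\<open>closed_subspace_vimage\<close>,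
  \<open>closed_subspace_INT\<close>).

  To speak of bounded maps between the two operator spaces, both have to be recognised as normed
  spaces.  Both carry the supremum of pointwise norms over a product of unit balls, so one
  lemma, \<open>normed_space_op_space\<close>, serves for the two; what it requires is that
  operators be bounded on unit balls and determined by their values there.  For multilinear
  operators both facts come from the same scaling argument (\<open>multilinear_op_scaled_bound\<close>).
\<close>

section \<open>Normed spaces and bounded linear maps\<close>

lemma scalars_simps [simp]:
  "carrier scalars = UNIV" "\<one>\<^bsub>scalars\<^esub> = 1" "\<zero>\<^bsub>scalars\<^esub> = 0"
  "a \<oplus>\<^bsub>scalars\<^esub> b = a + b" "a \<otimes>\<^bsub>scalars\<^esub> b = a * b"
  by (simp_all add: scalars_def)

context normed_space
begin

lemma a_inv_eq_smult: "x \<in> carrier E \<Longrightarrow> \<ominus> x = (-1) \<odot> x"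
proof -
  assume x: "x \<in> carrier E"
  have "\<ominus>\<^bsub>scalars\<^esub> (1::'k) = -1"
    by (rule R.minus_equality) simp_all
  then show ?thesis
    using smult_l_minus[of 1 x] smult_one[OF x] x by simp
qed

lemma vnorm_zero [simp]: "vnorm E \<zero> = 0"
  by (simp add: vnorm_eq_0_iff)

lemma vnorm_minus [simp]: "x \<in> carrier E \<Longrightarrow> vnorm E (\<ominus> x) = vnorm E x"
  by (simp add: a_inv_eq_smult vnorm_smult)

lemma smult_smult: "x \<in> carrier E \<Longrightarrow> a \<odot> (b \<odot> x) = (a * b) \<odot> x"
  using smult_assoc1[of a b x] by simp

lemma smult_closed' [simp]: "x \<in> carrier E \<Longrightarrow> c \<odot> x \<in> carrier E"
  by simp

lemma topspace_vtopology [simp]: "topspace (vtopology E) = carrier E"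
proof -
  interpret D: Metric_space "carrier E" "vdist E"
    by (rule Metric_space_vdist)
  show ?thesis
    by (simp add: vtopology_def)
qed

lemma continuous_map_into_vtopology:
  "continuous_map X (vtopology E) f \<longleftrightarrow>
    f \<in> topspace X \<rightarrow> carrier E \<and>
    (\<forall>x\<in>topspace X. \<forall>\<epsilon>>0. \<exists>U. openin X U \<and> x \<in> U \<and> (\<forall>y\<in>U. vnorm E (f x \<ominus> f y) < \<epsilon>))"
    (is "_ \<longleftrightarrow> ?R")
proof -
  interpret D: Metric_space "carrier E" "vdist E"
    by (rule Metric_space_vdist)
  have *: "f y \<in> D.mball (f x) \<epsilon> \<longleftrightarrow> f x \<in> carrier E \<and> f y \<in> carrier E \<and> vnorm E (f x \<ominus> f y) < \<epsilon>"
    for x y \<epsilon>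
    by (auto simp: vdist_def)
  show ?thesis
    unfolding vtopology_def D.continuous_map_to_metric *
  proof safe
    fix x assume "x \<in> topspace X" and
      "\<forall>x\<in>topspace X. \<forall>\<epsilon>>0. \<exists>U. openin X U \<and> x \<in> U \<and>
        (\<forall>y\<in>U. f x \<in> carrier E \<and> f y \<in> carrier E \<and> vnorm E (f x \<ominus> f y) < \<epsilon>)"
    then show "f x \<in> carrier E"
      using zero_less_one by blast
  next
    fix x and \<epsilon> :: real assume "x \<in> topspace X" "0 < \<epsilon>" and
      "\<forall>x\<in>topspace X. \<forall>\<epsilon>>0. \<exists>U. openin X U \<and> x \<in> U \<and>
        (\<forall>y\<in>U. f x \<in> carrier E \<and> f y \<in> carrier E \<and> vnorm E (f x \<ominus> f y) < \<epsilon>)"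
    then show "\<exists>U. openin X U \<and> x \<in> U \<and> (\<forall>y\<in>U. vnorm E (f x \<ominus> f y) < \<epsilon>)"
      by meson
  next
    fix x and \<epsilon> :: real assume "x \<in> topspace X" "0 < \<epsilon>" and f: "f \<in> topspace X \<rightarrow> carrier E" and
      "\<forall>x\<in>topspace X. \<forall>\<epsilon>>0. \<exists>U. openin X U \<and> x \<in> U \<and> (\<forall>y\<in>U. vnorm E (f x \<ominus> f y) < \<epsilon>)"
    then obtain U where "openin X U" "x \<in> U" "\<forall>y\<in>U. vnorm E (f x \<ominus> f y) < \<epsilon>"
      by meson
    moreover have "f y \<in> carrier E" if "y \<in> U" for y
      using that f \<open>openin X U\<close> openin_subset by fastforce
    ultimately show "\<exists>U. openin X U \<and> x \<in> U \<and>
        (\<forall>y\<in>U. f x \<in> carrier E \<and> f y \<in> carrier E \<and> vnorm E (f x \<ominus> f y) < \<epsilon>)"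
      by blast
  qed
qed

lemma continuous_map_add:
  assumes f: "continuous_map X (vtopology E) f" and g: "continuous_map X (vtopology E) g"
  shows "continuous_map X (vtopology E) (\<lambda>x. f x \<oplus> g x)"
  unfolding continuous_map_into_vtopology
proof (intro conjI ballI allI impI)
  have mem: "f x \<in> carrier E" "g x \<in> carrier E" if "x \<in> topspace X" for x
    using f g that by (auto simp: continuous_map_into_vtopology)
  show "(\<lambda>x. f x \<oplus> g x) \<in> topspace X \<rightarrow> carrier E"
    using mem by auto
  fix x and \<epsilon> :: real assume x: "x \<in> topspace X" and "0 < \<epsilon>"
  then have "0 < \<epsilon> / 2" by simp
  with f g x obtain U V where U: "openin X U" "x \<in> U" "\<forall>y\<in>U. vnorm E (f x \<ominus> f y) < \<epsilon> / 2"
    and V: "openin X V" "x \<in> V" "\<forall>y\<in>V. vnorm E (g x \<ominus> g y) < \<epsilon> / 2"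
    unfolding continuous_map_into_vtopology by meson
  have "vnorm E ((f x \<oplus> g x) \<ominus> (f y \<oplus> g y)) < \<epsilon>" if y: "y \<in> U \<inter> V" for y
  proof -
    have "y \<in> topspace X"
      using y U openin_subset by fastforce
    then have c: "f x \<in> carrier E" "g x \<in> carrier E" "f y \<in> carrier E" "g y \<in> carrier E"
      using mem x by auto
    then have "(f x \<oplus> g x) \<ominus> (f y \<oplus> g y) = (f x \<ominus> f y) \<oplus> (g x \<ominus> g y)"
      by (simp add: a_minus_def M.minus_add M.a_ac)
    then have "vnorm E ((f x \<oplus> g x) \<ominus> (f y \<oplus> g y)) \<le> vnorm E (f x \<ominus> f y) + vnorm E (g x \<ominus> g y)"
      using c vnorm_triangle by simp
    also have "\<dots> < \<epsilon> / 2 + \<epsilon> / 2"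
      using U V y by (intro add_strict_mono) auto
    finally show ?thesis by simp
  qed
  then show "\<exists>U. openin X U \<and> x \<in> U \<and> (\<forall>y\<in>U. vnorm E ((f x \<oplus> g x) \<ominus> (f y \<oplus> g y)) < \<epsilon>)"
    using U V by (intro exI[of _ "U \<inter> V"]) auto
qed

lemma continuous_map_smult:
  assumes f: "continuous_map X (vtopology E) f"
  shows "continuous_map X (vtopology E) (\<lambda>x. c \<odot> f x)"
  unfolding continuous_map_into_vtopology
proof (intro conjI ballI allI impI)
  have mem: "f x \<in> carrier E" if "x \<in> topspace X" for x
    using f that by (auto simp: continuous_map_into_vtopology)
  show "(\<lambda>x. c \<odot> f x) \<in> topspace X \<rightarrow> carrier E"
    using mem by auto
  fix x and \<epsilon> :: real assume x: "x \<in> topspace X" and "0 < \<epsilon>"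
  (* The summand 1 makes the divisor positive even when the scalar is 0. *)
  then have "0 < \<epsilon> / (norm c + 1)"
    by (simp add: add_nonneg_pos)
  with f x obtain U where U: "openin X U" "x \<in> U"
    "\<forall>y\<in>U. vnorm E (f x \<ominus> f y) < \<epsilon> / (norm c + 1)"
    unfolding continuous_map_into_vtopology by meson
  have "vnorm E (c \<odot> f x \<ominus> c \<odot> f y) < \<epsilon>" if y: "y \<in> U" for y
  proof -
    have "y \<in> topspace X"
      using y U openin_subset by fastforce
    then have m: "f x \<in> carrier E" "f y \<in> carrier E"
      using mem x by auto
    then have "c \<odot> f x \<ominus> c \<odot> f y = c \<odot> (f x \<ominus> f y)"
      by (simp add: a_minus_def smult_r_distr smult_r_minus)
    then have "vnorm E (c \<odot> f x \<ominus> c \<odot> f y) = norm c * vnorm E (f x \<ominus> f y)"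
      using m vnorm_smult by simp
    also have "\<dots> \<le> (norm c + 1) * vnorm E (f x \<ominus> f y)"
      using m vnorm_nonneg by (intro mult_right_mono) auto
    also have "\<dots> < \<epsilon>"
      using U y by (simp add: less_divide_eq add_nonneg_pos mult.commute)
    finally show ?thesis .
  qed
  then show "\<exists>U. openin X U \<and> x \<in> U \<and> (\<forall>y\<in>U. vnorm E (c \<odot> f x \<ominus> c \<odot> f y) < \<epsilon>)"
    using U by blast
qed

end

lemma linear_op_zero:
  assumes "normed_space E" "normed_space F" "linear_op E F u"
  shows "u \<zero>\<^bsub>E\<^esub> = \<zero>\<^bsub>F\<^esub>"
proof -
  interpret E: normed_space E by fact
  interpret F: normed_space F by fact
  have "u \<zero>\<^bsub>E\<^esub> = u (0 \<odot>\<^bsub>E\<^esub> \<zero>\<^bsub>E\<^esub>)"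
    using E.smult_l_null[of "\<zero>\<^bsub>E\<^esub>"] by simp
  also have "\<dots> = 0 \<odot>\<^bsub>F\<^esub> u \<zero>\<^bsub>E\<^esub>"
    using assms(3) E.M.zero_closed unfolding linear_op_def by blast
  also have "\<dots> = \<zero>\<^bsub>F\<^esub>"
    using F.smult_l_null[of "u \<zero>\<^bsub>E\<^esub>"] assms(3) by (auto simp: linear_op_def)
  finally show ?thesis .
qed

lemma linear_op_diff:
  assumes "normed_space E" "normed_space F" "linear_op E F u" "x \<in> carrier E" "y \<in> carrier E"
  shows "u (x \<ominus>\<^bsub>E\<^esub> y) = u x \<ominus>\<^bsub>F\<^esub> u y"
proof -
  interpret E: normed_space E by fact
  interpret F: normed_space F by fact
  have "u y \<in> carrier F"
    using assms by (auto simp: linear_op_def)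
  then show ?thesis
    using assms
    by (simp add: a_minus_def E.a_inv_eq_smult F.a_inv_eq_smult linear_op_def)
qed

lemma linear_op_unit_ball_bound:
  fixes E :: "('k::real_normed_field, 'a) normed" and F :: "('k, 'b) normed"
  assumes "normed_space E" "normed_space F" and u: "linear_op E F u"
    and K: "\<And>x. x \<in> carrier E \<Longrightarrow> vnorm E x \<le> 1 \<Longrightarrow> vnorm F (u x) \<le> K"
    and x: "x \<in> carrier E"
  shows "vnorm F (u x) \<le> K * vnorm E x"
proof (cases "vnorm E x = 0")
  interpret E: normed_space E by fact
  interpret F: normed_space F by fact
  case True
  then show ?thesis
    using x linear_op_zero[OF assms(1-3)] by (simp add: E.vnorm_eq_0_iff)
next
  interpret E: normed_space E by fact
  interpret F: normed_space F by fact
  case False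
  then have pos: "vnorm E x > 0"
    using E.vnorm_nonneg[OF x] by simp
  define c :: 'k where "c = of_real (inverse (vnorm E x))"
  have c: "norm c = inverse (vnorm E x)"
    using pos by (simp add: c_def norm_inverse)
  have ux: "u x \<in> carrier F"
    using u x by (auto simp: linear_op_def)
  have "norm c * vnorm F (u x) = vnorm F (u (c \<odot>\<^bsub>E\<^esub> x))"
    using u x F.vnorm_smult[OF ux] by (simp add: linear_op_def)
  also have "\<dots> \<le> K"
    using x pos by (intro K) (simp_all add: E.vnorm_smult c)
  finally show ?thesis
    using pos by (simp add: c field_simps)
qed

lemma linear_op_extensional_add:
  assumes "normed_space E" "normed_space F" and u: "linear_op E F u" and v: "linear_op E F v"
  shows "linear_op E F (\<lambda>x\<in>carrier E. u x \<oplus>\<^bsub>F\<^esub> v x)"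
proof -
  interpret E: normed_space E by fact
  interpret F: normed_space F by fact
  have mem: "u x \<in> carrier F" "v x \<in> carrier F" if "x \<in> carrier E" for x
    using that u v by (auto simp: linear_op_def)
  have "u (x \<oplus>\<^bsub>E\<^esub> y) \<oplus>\<^bsub>F\<^esub> v (x \<oplus>\<^bsub>E\<^esub> y) = (u x \<oplus>\<^bsub>F\<^esub> v x) \<oplus>\<^bsub>F\<^esub> (u y \<oplus>\<^bsub>F\<^esub> v y)"
    if "x \<in> carrier E" "y \<in> carrier E" for x y
    using that u v mem by (simp add: linear_op_def F.M.a_ac)
  moreover have "u (c \<odot>\<^bsub>E\<^esub> x) \<oplus>\<^bsub>F\<^esub> v (c \<odot>\<^bsub>E\<^esub> x) = c \<odot>\<^bsub>F\<^esub> (u x \<oplus>\<^bsub>F\<^esub> v x)"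
    if "x \<in> carrier E" for x c
    using that u v mem by (simp add: linear_op_def F.smult_r_distr)
  ultimately show ?thesis
    using mem by (simp add: linear_op_def)
qed

lemma linear_op_extensional_smult:
  assumes "normed_space E" "normed_space F" and u: "linear_op E F u"
  shows "linear_op E F (\<lambda>x\<in>carrier E. c \<odot>\<^bsub>F\<^esub> u x)"
proof -
  interpret E: normed_space E by fact
  interpret F: normed_space F by fact
  have mem: "u x \<in> carrier F" if "x \<in> carrier E" for x
    using that u by (auto simp: linear_op_def)
  have "c \<odot>\<^bsub>F\<^esub> u (x \<oplus>\<^bsub>E\<^esub> y) = c \<odot>\<^bsub>F\<^esub> u x \<oplus>\<^bsub>F\<^esub> c \<odot>\<^bsub>F\<^esub> u y"
    if "x \<in> carrier E" "y \<in> carrier E" for x y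
    using that u mem by (simp add: linear_op_def F.smult_r_distr)
  moreover have "c \<odot>\<^bsub>F\<^esub> u (d \<odot>\<^bsub>E\<^esub> x) = d \<odot>\<^bsub>F\<^esub> (c \<odot>\<^bsub>F\<^esub> u x)"
    if "x \<in> carrier E" for x d
    using that u mem by (simp add: linear_op_def F.smult_smult mult.commute)
  ultimately show ?thesis
    using mem by (simp add: linear_op_def)
qed

lemma linear_op_extensional_zero:
  assumes "normed_space E" "normed_space F"
  shows "linear_op E F (\<lambda>x\<in>carrier E. \<zero>\<^bsub>F\<^esub>)"
proof -
  interpret E: normed_space E by fact
  interpret F: normed_space F by fact
  have "c \<odot>\<^bsub>F\<^esub> \<zero>\<^bsub>F\<^esub> = \<zero>\<^bsub>F\<^esub>" for c
    by simp
  then show ?thesis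
    by (simp add: linear_op_def)
qed

lemma continuous_map_bounded_linear:
  assumes "normed_space X" "normed_space Y" and T: "linear_op X Y T"
    and K: "\<And>x. x \<in> carrier X \<Longrightarrow> vnorm Y (T x) \<le> K * vnorm X x"
  shows "continuous_map (vtopology X) (vtopology Y) T"
proof -
  interpret X: normed_space X by fact
  interpret Y: normed_space Y by fact
  interpret D: Metric_space "carrier X" "vdist X"
    by (rule X.Metric_space_vdist)
  interpret D': Metric_space "carrier Y" "vdist Y"
    by (rule Y.Metric_space_vdist)
  (* K may be zero or negative, so |K| + 1 replaces it as a divisor. *)
  have lip: "vdist Y (T a) (T x) \<le> (\<bar>K\<bar> + 1) * vdist X a x" if "a \<in> carrier X" "x \<in> carrier X" for a x
  proof -
    have "vdist Y (T a) (T x) = vnorm Y (T (a \<ominus>\<^bsub>X\<^esub> x))"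
      using T that by (simp add: vdist_def linear_op_diff[OF assms(1,2)]) (auto simp: linear_op_def)
    also have "\<dots> \<le> K * vnorm X (a \<ominus>\<^bsub>X\<^esub> x)"
      using that by (intro K) simp
    also have "\<dots> \<le> (\<bar>K\<bar> + 1) * vnorm X (a \<ominus>\<^bsub>X\<^esub> x)"
      using that X.vnorm_nonneg by (intro mult_right_mono) auto
    finally show ?thesis
      using that by (simp add: vdist_def)
  qed
  have "\<exists>\<delta>>0. \<forall>x. x \<in> carrier X \<and> vdist X a x < \<delta> \<longrightarrow> vdist Y (T a) (T x) < \<epsilon>"
    if a: "a \<in> carrier X" and "\<epsilon> > 0" for a \<epsilon>
  proof (intro exI[of _ "\<epsilon> / (\<bar>K\<bar> + 1)"] conjI allI impI)
    show "0 < \<epsilon> / (\<bar>K\<bar> + 1)"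
      using \<open>\<epsilon> > 0\<close> by simp
    fix x assume x: "x \<in> carrier X \<and> vdist X a x < \<epsilon> / (\<bar>K\<bar> + 1)"
    then have "(\<bar>K\<bar> + 1) * vdist X a x < \<epsilon>"
      by (simp add: pos_less_divide_eq add_nonneg_pos mult.commute)
    then show "vdist Y (T a) (T x) < \<epsilon>"
      using lip[of a x] a x by linarith
  qed
  then show ?thesis
    using T unfolding vtopology_def D.metric_continuous_map[OF D'.Metric_space_axioms]
    by (auto simp: linear_op_def)
qed

section \<open>Closed subspaces\<close>

lemma closed_subspace_vimage:
  assumes "normed_space X" "normed_space Y" and T: "linear_op X Y T"
    and K: "\<And>x. x \<in> carrier X \<Longrightarrow> vnorm Y (T x) \<le> K * vnorm X x"
    and S: "closed_subspace S Y"
  shows "closed_subspace {x \<in> carrier X. T x \<in> S} X"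
proof -
  interpret X: normed_space X by fact
  interpret Y: normed_space Y by fact
  have sub: "submodule S scalars Y"
    using S by (simp add: closed_subspace_def)
  note SE = Y.submoduleE[OF sub]
  have smult: "c \<odot>\<^bsub>Y\<^esub> y \<in> S" if "y \<in> S" for c y
    using SE(4)[of c y] that by simp
  have "\<zero>\<^bsub>Y\<^esub> \<in> S"
    using submodule.axioms(1)[OF sub] subgroup.one_closed by fastforce
  have "submodule {x \<in> carrier X. T x \<in> S} scalars X"
  proof (rule X.submoduleI)
    show "\<zero>\<^bsub>X\<^esub> \<in> {x \<in> carrier X. T x \<in> S}"
      using \<open>\<zero>\<^bsub>Y\<^esub> \<in> S\<close> linear_op_zero[OF assms(1-3)] by simp
    show "\<ominus>\<^bsub>X\<^esub> a \<in> {x \<in> carrier X. T x \<in> S}" if "a \<in> {x \<in> carrier X. T x \<in> S}" for a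
      using that smult[of "T a" "-1"] T by (simp add: X.a_inv_eq_smult linear_op_def)
    show "a \<oplus>\<^bsub>X\<^esub> b \<in> {x \<in> carrier X. T x \<in> S}"
      if "a \<in> {x \<in> carrier X. T x \<in> S}" "b \<in> {x \<in> carrier X. T x \<in> S}" for a b
      using that SE(5)[of "T a" "T b"] T by (simp add: linear_op_def)
    show "c \<odot>\<^bsub>X\<^esub> a \<in> {x \<in> carrier X. T x \<in> S}" if "a \<in> {x \<in> carrier X. T x \<in> S}" for c a
      using that smult[of "T a" c] T by (simp add: linear_op_def)
  qed auto
  moreover have "closedin (vtopology X) {x \<in> carrier X. T x \<in> S}"
    using closedin_continuous_map_preimage[OF continuous_map_bounded_linear[OF assms(1-4)]] S
    by (simp add: closed_subspace_def)
  ultimately show ?thesis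
    by (simp add: closed_subspace_def)
qed

lemma closed_subspace_INT:
  assumes "normed_space X" "I \<noteq> {}" and S: "\<And>i. i \<in> I \<Longrightarrow> closed_subspace (S i) X"
  shows "closed_subspace (\<Inter>i\<in>I. S i) X"
proof -
  interpret X: normed_space X by fact
  have sub: "submodule (S i) scalars X" if "i \<in> I" for i
    using S[OF that] by (simp add: closed_subspace_def)
  note SE = X.submoduleE[OF sub]
  have "submodule (\<Inter>i\<in>I. S i) scalars X"
  proof (rule X.submoduleI)
    show "(\<Inter>i\<in>I. S i) \<subseteq> carrier X"
      using SE(1) \<open>I \<noteq> {}\<close> by blast
    show "\<zero>\<^bsub>X\<^esub> \<in> (\<Inter>i\<in>I. S i)"
      using submodule.axioms(1)[OF sub] subgroup.one_closed by fastforce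
  qed (use SE in auto)
  moreover have "closedin (vtopology X) (\<Inter>i\<in>I. S i)"
    using S \<open>I \<noteq> {}\<close> by (intro closedin_INT) (auto simp: closed_subspace_def)
  ultimately show ?thesis
    by (simp add: closed_subspace_def)
qed

section \<open>Spaces of operators\<close>

lemma op_space_simps [simp]:
  "carrier (op_space D L N F) = L"
  "\<zero>\<^bsub>op_space D L N F\<^esub> = (\<lambda>x\<in>D. \<zero>\<^bsub>F\<^esub>)"
  "u \<oplus>\<^bsub>op_space D L N F\<^esub> v = (\<lambda>x\<in>D. u x \<oplus>\<^bsub>F\<^esub> v x)"
  "c \<odot>\<^bsub>op_space D L N F\<^esub> u = (\<lambda>x\<in>D. c \<odot>\<^bsub>F\<^esub> u x)"
  "vnorm (op_space D L N F) = N"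
  by (simp_all add: op_space_def)

text \<open>
  Pointwise operations inherit the module axioms from the target.  The supremum over \<open>B\<close> is a
  norm as soon as it is finite and \<open>B\<close> is large enough to separate operators.
\<close>

lemma normed_space_op_space:
  fixes F :: "('k::real_normed_field, 'b) normed"
  assumes F: "normed_space F"
    and L: "L \<subseteq> D \<rightarrow>\<^sub>E carrier F"
    and zero: "(\<lambda>x\<in>D. \<zero>\<^bsub>F\<^esub>) \<in> L"
    and add: "\<And>u v. u \<in> L \<Longrightarrow> v \<in> L \<Longrightarrow> (\<lambda>x\<in>D. u x \<oplus>\<^bsub>F\<^esub> v x) \<in> L"
    and smult: "\<And>c u. u \<in> L \<Longrightarrow> (\<lambda>x\<in>D. c \<odot>\<^bsub>F\<^esub> u x) \<in> L"
    and B: "B \<subseteq> D" "B \<noteq> {}"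
    and bdd: "\<And>u. u \<in> L \<Longrightarrow> \<exists>K. \<forall>x\<in>B. vnorm F (u x) \<le> K"
    and sep: "\<And>u x. u \<in> L \<Longrightarrow> \<forall>x\<in>B. u x = \<zero>\<^bsub>F\<^esub> \<Longrightarrow> x \<in> D \<Longrightarrow> u x = \<zero>\<^bsub>F\<^esub>"
  shows "normed_space (op_space D L (\<lambda>u. SUP x\<in>B. vnorm F (u x)) F)"
proof -
  interpret F: normed_space F by fact
  let ?X = "op_space D L (\<lambda>u. SUP x\<in>B. vnorm F (u x)) F"
  let ?N = "\<lambda>u. SUP x\<in>B. vnorm F (u x)"
  have mem: "u x \<in> carrier F" if "u \<in> L" "x \<in> D" for u x
    using L that by auto
  have ext: "u \<in> extensional D" if "u \<in> L" for u
    using L that by (auto simp: PiE_def)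
  have upper: "vnorm F (u x) \<le> ?N u" if "u \<in> L" "x \<in> B" for u x
    using bdd[OF \<open>u \<in> L\<close>] that by (intro cSUP_upper) (auto simp: bdd_above_def)
  have least: "?N u \<le> K" if "\<And>x. x \<in> B \<Longrightarrow> vnorm F (u x) \<le> K" for u K
    using that B by (intro cSUP_least) auto
  have nonneg: "0 \<le> ?N u" if "u \<in> L" for u
  proof -
    obtain b where "b \<in> B"
      using B by blast
    then have "0 \<le> vnorm F (u b)"
      using B mem that by (intro F.vnorm_nonneg) auto
    also have "\<dots> \<le> ?N u"
      by (rule upper) fact+
    finally show ?thesis .
  qed
  have eqI: "u = v" if "u \<in> extensional D" "v \<in> extensional D" "\<And>x. x \<in> D \<Longrightarrow> u x = v x"
    for u v
    using that by (rule extensionalityI)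
  have "abelian_group ?X"
  proof (rule abelian_groupI)
    fix u assume u: "u \<in> carrier ?X"
    then have "(\<lambda>x\<in>D. (-1) \<odot>\<^bsub>F\<^esub> u x) \<in> carrier ?X"
      by (simp add: smult)
    moreover have "(\<lambda>x\<in>D. (-1) \<odot>\<^bsub>F\<^esub> u x) \<oplus>\<^bsub>?X\<^esub> u = \<zero>\<^bsub>?X\<^esub>"
      using u mem by (auto simp: F.a_inv_eq_smult[symmetric] F.M.l_neg intro!: restrict_ext)
    ultimately show "\<exists>v\<in>carrier ?X. v \<oplus>\<^bsub>?X\<^esub> u = \<zero>\<^bsub>?X\<^esub>"
      by blast
  qed (auto simp: add zero mem ext F.M.a_ac intro!: restrict_ext eqI)
  then have "Module.module scalars ?X"
  proof (rule moduleI[OF F.R.is_cring])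
    show "(a \<oplus>\<^bsub>scalars\<^esub> b) \<odot>\<^bsub>?X\<^esub> u = a \<odot>\<^bsub>?X\<^esub> u \<oplus>\<^bsub>?X\<^esub> b \<odot>\<^bsub>?X\<^esub> u" if "u \<in> carrier ?X" for a b u
      using that mem F.smult_l_distr[of a b] by (auto intro!: restrict_ext)
    show "a \<odot>\<^bsub>?X\<^esub> (u \<oplus>\<^bsub>?X\<^esub> v) = a \<odot>\<^bsub>?X\<^esub> u \<oplus>\<^bsub>?X\<^esub> a \<odot>\<^bsub>?X\<^esub> v"
      if "u \<in> carrier ?X" "v \<in> carrier ?X" for a u v
      using that mem F.smult_r_distr[of a] by (auto intro!: restrict_ext)
    show "(a \<otimes>\<^bsub>scalars\<^esub> b) \<odot>\<^bsub>?X\<^esub> u = a \<odot>\<^bsub>?X\<^esub> (b \<odot>\<^bsub>?X\<^esub> u)" if "u \<in> carrier ?X" for a b u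
      using that mem by (auto simp: F.smult_smult intro!: restrict_ext)
    show "\<one>\<^bsub>scalars\<^esub> \<odot>\<^bsub>?X\<^esub> u = u" if "u \<in> carrier ?X" for u
      using that mem F.smult_one by (auto intro!: eqI simp: ext)
  qed (simp add: smult)
  moreover have "normed_space_axioms ?X"
  proof
    fix u assume "u \<in> carrier ?X"
    then have u: "u \<in> L" by simp
    show "0 \<le> vnorm ?X u"
      using nonneg u by simp
    show "vnorm ?X u = 0 \<longleftrightarrow> u = \<zero>\<^bsub>?X\<^esub>"
    proof
      assume 0: "vnorm ?X u = 0"
      have "u x = \<zero>\<^bsub>F\<^esub>" if "x \<in> B" for x
      proof -
        have "u x \<in> carrier F"
          using mem u that B by blast
        moreover have "vnorm F (u x) \<le> 0"
          using upper[OF u that] 0 by simp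
        ultimately show ?thesis
          using F.vnorm_nonneg F.vnorm_eq_0_iff by force
      qed
      then show "u = \<zero>\<^bsub>?X\<^esub>"
        using sep u by (auto intro!: eqI simp: ext)
    next
      assume eq: "u = \<zero>\<^bsub>?X\<^esub>"
      have "u x = \<zero>\<^bsub>F\<^esub>" if "x \<in> B" for x
        using fun_cong[OF eq, of x] that B by auto
      then have "?N u \<le> 0"
        by (intro least) simp
      then show "vnorm ?X u = 0"
        using nonneg[OF u] by simp
    qed
    show "vnorm ?X (u \<oplus>\<^bsub>?X\<^esub> v) \<le> vnorm ?X u + vnorm ?X v" if "v \<in> carrier ?X" for v
    proof -
      have v: "v \<in> L"
        using that by simp
      have "?N (\<lambda>x\<in>D. u x \<oplus>\<^bsub>F\<^esub> v x) \<le> ?N u + ?N v"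
      proof (rule least)
        fix x assume x: "x \<in> B"
        then have "x \<in> D" using B by auto
        then have "vnorm F ((\<lambda>x\<in>D. u x \<oplus>\<^bsub>F\<^esub> v x) x) \<le> vnorm F (u x) + vnorm F (v x)"
          using F.vnorm_triangle mem u v by simp
        then show "vnorm F ((\<lambda>x\<in>D. u x \<oplus>\<^bsub>F\<^esub> v x) x) \<le> ?N u + ?N v"
          using upper[OF u x] upper[OF v x] by linarith
      qed
      then show ?thesis
        by simp
    qed
    show "vnorm ?X (c \<odot>\<^bsub>?X\<^esub> u) = norm c * vnorm ?X u" for c
    proof -
      let ?cu = "\<lambda>x\<in>D. c \<odot>\<^bsub>F\<^esub> u x"
      have cu: "vnorm F (?cu x) = norm c * vnorm F (u x)" if "x \<in> B" for x
        using that B mem u F.vnorm_smult by auto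
      have "?N ?cu \<le> norm c * ?N u"
        using upper[OF u] by (intro least) (simp only: cu mult_left_mono norm_ge_zero)
      moreover have "norm c * ?N u \<le> ?N ?cu"
      proof (cases "c = 0")
        case True
        then show ?thesis
          using nonneg[OF smult[OF u, of c]] by simp
      next
        case False
        have "?N u \<le> ?N ?cu / norm c"
        proof (rule least)
          fix x assume "x \<in> B"
          then show "vnorm F (u x) \<le> ?N ?cu / norm c"
            using upper[OF smult[OF u, of c], of x] cu[of x] False
            by (simp add: field_simps)
        qed
        then show ?thesis
          using False by (simp add: field_simps)
      qed
      ultimately show ?thesis
        by simp
    qed
  qed
  ultimately show ?thesis
    by (rule normed_space.intro)
qed

lemma normed_space_bounded_linear_ops:
  fixes E :: "('k::real_normed_field, 'a) normed" and F :: "('k, 'b) normed"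
  assumes E: "normed_space E" and F: "normed_space F"
  shows "normed_space (bounded_linear_ops E F)"
proof -
  interpret E: normed_space E by fact
  interpret F: normed_space F by fact
  show ?thesis
    unfolding bounded_linear_ops_def
  proof (rule normed_space_op_space[OF F])
    let ?L = "{u \<in> extensional (carrier E).
      linear_op E F u \<and> (\<exists>M. \<forall>x\<in>carrier E. vnorm F (u x) \<le> M * vnorm E x)}"
    let ?B = "{x \<in> carrier E. vnorm E x \<le> 1}"
    show "?L \<subseteq> carrier E \<rightarrow>\<^sub>E carrier F"
      by (auto simp: PiE_def linear_op_def)
    show "(\<lambda>x\<in>carrier E. \<zero>\<^bsub>F\<^esub>) \<in> ?L"
      using linear_op_extensional_zero[OF E F] by (auto intro!: exI[of _ 0])
    show "(\<lambda>x\<in>carrier E. u x \<oplus>\<^bsub>F\<^esub> v x) \<in> ?L" if uv: "u \<in> ?L" "v \<in> ?L" for u v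
    proof -
      obtain M N where M: "\<forall>x\<in>carrier E. vnorm F (u x) \<le> M * vnorm E x"
        and N: "\<forall>x\<in>carrier E. vnorm F (v x) \<le> N * vnorm E x"
        using uv by auto
      have "vnorm F (u x \<oplus>\<^bsub>F\<^esub> v x) \<le> (M + N) * vnorm E x" if "x \<in> carrier E" for x
      proof -
        have "u x \<in> carrier F" "v x \<in> carrier F"
          using uv that by (auto simp: linear_op_def)
        then show ?thesis
          using F.vnorm_triangle[of "u x" "v x"] M N that by (force simp: distrib_right)
      qed
      then show ?thesis
        using linear_op_extensional_add[OF E F] uv by (auto intro!: exI[of _ "M + N"])
    qed
    show "(\<lambda>x\<in>carrier E. c \<odot>\<^bsub>F\<^esub> u x) \<in> ?L" if u: "u \<in> ?L" for u c
    proof -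
      obtain M where M: "\<forall>x\<in>carrier E. vnorm F (u x) \<le> M * vnorm E x"
        using u by auto
      have "vnorm F (c \<odot>\<^bsub>F\<^esub> u x) \<le> (norm c * M) * vnorm E x" if "x \<in> carrier E" for x
      proof -
        have "u x \<in> carrier F"
          using u that by (auto simp: linear_op_def)
        then show ?thesis
          using F.vnorm_smult[of "u x" c] M that by (simp add: mult_left_mono mult.assoc)
      qed
      then show ?thesis
        using linear_op_extensional_smult[OF E F] u by (auto intro!: exI[of _ "norm c * M"])
    qed
    have "\<zero>\<^bsub>E\<^esub> \<in> ?B"
      by simp
    then show "?B \<noteq> {}"
      by blast
    show "\<exists>K. \<forall>x\<in>?B. vnorm F (u x) \<le> K" if u: "u \<in> ?L" for u
    proof -
      obtain M where M: "\<forall>x\<in>carrier E. vnorm F (u x) \<le> M * vnorm E x"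
        using u by auto
      have "vnorm F (u x) \<le> \<bar>M\<bar>" if "x \<in> ?B" for x
      proof -
        have "vnorm F (u x) \<le> M * vnorm E x"
          using M that by auto
        also have "\<dots> \<le> \<bar>M\<bar> * 1"
          using that E.vnorm_nonneg by (intro mult_mono) auto
        finally show ?thesis by simp
      qed
      then show ?thesis by blast
    qed
    show "u x = \<zero>\<^bsub>F\<^esub>" if u: "u \<in> ?L" and 0: "\<forall>x\<in>?B. u x = \<zero>\<^bsub>F\<^esub>" and x: "x \<in> carrier E" for u x
    proof -
      have ux: "u x \<in> carrier F"
        using u x by (auto simp: linear_op_def)
      have "vnorm F (u x) \<le> 0 * vnorm E x"
        using u x 0 by (intro linear_op_unit_ball_bound[OF E F]) auto
      then show ?thesis
        using F.vnorm_nonneg[OF ux] F.vnorm_eq_0_iff[OF ux] by simp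
    qed
  qed auto
qed

section \<open>Multilinear operators\<close>

lemma tuples_update:
  "a \<in> tuples m E \<Longrightarrow> k \<in> {1..m} \<Longrightarrow> x \<in> carrier (E k) \<Longrightarrow> a(k := x) \<in> tuples m E"
  by (auto simp: PiE_iff extensional_def)

text \<open>Induction on the number of scaled positions: each further position contributes one factor.\<close>

lemma multilinear_op_scale_on:
  fixes F :: "('k::real_normed_field, 'b) normed"
  assumes E: "\<And>i. i \<in> {1..m} \<Longrightarrow> normed_space (E i)" and F: "normed_space F"
    and A: "multilinear_op m E F A" and x: "x \<in> tuples m E"
    and S: "S \<subseteq> {1..m}"
  shows "A (\<lambda>i\<in>{1..m}. if i \<in> S then c \<odot>\<^bsub>E i\<^esub> x i else x i) = c ^ card S \<odot>\<^bsub>F\<^esub> A x"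
proof -
  interpret F: normed_space F by fact
  have Ax: "A y \<in> carrier F" if "y \<in> tuples m E" for y
    using A that by (auto simp: multilinear_op_def)
  let ?t = "\<lambda>S. \<lambda>i\<in>{1..m}. if i \<in> S then c \<odot>\<^bsub>E i\<^esub> x i else x i"
  have t: "?t S \<in> tuples m E" for S
    using x by (auto simp: PiE_iff intro!: normed_space.smult_closed' E)
  have "finite S"
    using S finite_subset by blast
  then show ?thesis
    using S
  proof (induction S)
    case empty
    have "?t {} = x"
      using x by (auto simp: PiE_def intro!: extensionalityI[of _ "{1..m}"])
    then show ?case
      using F.smult_one[OF Ax[OF x]] by simp
  next
    case (insert k S)
    then have k: "k \<in> {1..m}" by simp
    then have xk: "x k \<in> carrier (E k)"
      using x by auto
    have ck: "c \<odot>\<^bsub>E k\<^esub> x k \<in> carrier (E k)"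
      using normed_space.smult_closed'[OF E[OF k] xk] .
    have lin: "linear_op (E k) F (slice E A (?t S) k)"
      using A k t by (auto simp: multilinear_op_def)
    have "?t (insert k S) = (?t S)(k := c \<odot>\<^bsub>E k\<^esub> x k)"
      using k by (auto simp: fun_eq_iff)
    moreover have "(?t S)(k := x k) = ?t S"
      using k insert.hyps by (auto simp: fun_eq_iff)
    ultimately have slices: "slice E A (?t S) k (c \<odot>\<^bsub>E k\<^esub> x k) = A (?t (insert k S))"
      "slice E A (?t S) k (x k) = A (?t S)"
      using xk ck by (simp_all only: slice_def restrict_apply if_True)
    have "slice E A (?t S) k (c \<odot>\<^bsub>E k\<^esub> x k) = c \<odot>\<^bsub>F\<^esub> slice E A (?t S) k (x k)"
      using lin xk unfolding linear_op_def by blast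
    then have "A (?t (insert k S)) = c \<odot>\<^bsub>F\<^esub> A (?t S)"
      by (simp only: slices)
    also have "A (?t S) = c ^ card S \<odot>\<^bsub>F\<^esub> A x"
      using insert.IH insert.prems by blast
    also have "c \<odot>\<^bsub>F\<^esub> (c ^ card S \<odot>\<^bsub>F\<^esub> A x) = c ^ card (insert k S) \<odot>\<^bsub>F\<^esub> A x"
      using insert.hyps F.smult_smult[OF Ax[OF x]] by simp
    finally show ?case .
  qed
qed

text \<open>Scaling all entries by \<open>\<delta> / R\<close> moves a tuple of radius \<open>R\<close> to one of radius \<open>\<delta>\<close>.\<close>

lemma multilinear_op_scaled_bound:
  fixes F :: "('k::real_normed_field, 'b) normed"
  assumes E: "\<And>i. i \<in> {1..m} \<Longrightarrow> normed_space (E i)" and F: "normed_space F"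
    and A: "multilinear_op m E F A"
    and \<delta>: "0 < \<delta>" and R: "0 < R"
    and K: "\<And>x. x \<in> tuples m E \<Longrightarrow> \<forall>i\<in>{1..m}. vnorm (E i) (x i) \<le> \<delta> \<Longrightarrow> vnorm F (A x) \<le> K"
    and x: "x \<in> tuples m E" "\<forall>i\<in>{1..m}. vnorm (E i) (x i) \<le> R"
  shows "vnorm F (A x) \<le> (R / \<delta>) ^ m * K"
proof -
  interpret F: normed_space F by fact
  define c :: 'k where "c = of_real (\<delta> / R)"
  have c: "norm c = \<delta> / R"
    using \<delta> R unfolding c_def norm_of_real by simp
  let ?y = "\<lambda>i\<in>{1..m}. c \<odot>\<^bsub>E i\<^esub> x i"
  have "?y = (\<lambda>i\<in>{1..m}. if i \<in> {1..m} then c \<odot>\<^bsub>E i\<^esub> x i else x i)"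
    by (auto simp: fun_eq_iff)
  then have "A ?y = c ^ m \<odot>\<^bsub>F\<^esub> A x"
    using multilinear_op_scale_on[OF E F A x(1) subset_refl, of c] by simp
  moreover have "A x \<in> carrier F"
    using A x by (auto simp: multilinear_op_def)
  ultimately have "(\<delta> / R) ^ m * vnorm F (A x) = vnorm F (A ?y)"
    using F.vnorm_smult by (simp add: norm_power c)
  also have "\<dots> \<le> K"
  proof (rule K)
    show "?y \<in> tuples m E"
      using x by (auto simp: PiE_iff intro!: normed_space.smult_closed' E)
    have "vnorm (E i) (c \<odot>\<^bsub>E i\<^esub> x i) \<le> \<delta>" if i: "i \<in> {1..m}" for i
    proof -
      have "x i \<in> carrier (E i)"
        using x(1) i by auto
      then have "vnorm (E i) (c \<odot>\<^bsub>E i\<^esub> x i) = \<delta> / R * vnorm (E i) (x i)"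
        using normed_space.vnorm_smult[OF E[OF i]] by (simp add: c)
      also have "\<dots> \<le> \<delta> / R * R"
        using x(2) i \<delta> R by (intro mult_left_mono) auto
      finally show ?thesis
        using R by simp
    qed
    then show "\<forall>i\<in>{1..m}. vnorm (E i) (?y i) \<le> \<delta>"
      by simp
  qed
  finally show ?thesis
    using \<delta> R by (simp add: power_divide field_simps)
qed

text \<open>
  Continuity at the zero tuple confines \<open>A\<close> to a ball of radius 1 around its value there on some
  product of balls of a common radius \<open>\<delta>\<close>, which scaling enlarges to the unit balls.
\<close>

lemma continuous_multilinear_op_bounded:
  fixes F :: "('k::real_normed_field, 'b) normed"
  assumes E: "\<And>i. i \<in> {1..m} \<Longrightarrow> normed_space (E i)" and F: "normed_space F"
    and A: "multilinear_op m E F A"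
    and cont: "continuous_map (product_topology (\<lambda>i. vtopology (E i)) {1..m}) (vtopology F) A"
  shows "\<exists>K. \<forall>x\<in>tuples m E. (\<forall>i\<in>{1..m}. vnorm (E i) (x i) \<le> 1) \<longrightarrow> vnorm F (A x) \<le> K"
proof -
  interpret F: normed_space F by fact
  let ?P = "product_topology (\<lambda>i. vtopology (E i)) {1..m}"
  let ?z = "\<lambda>i\<in>{1..m}. \<zero>\<^bsub>E i\<^esub>"
  have Ax: "A y \<in> carrier F" if "y \<in> tuples m E" for y
    using A that by (auto simp: multilinear_op_def)
  have zero_closed: "\<zero>\<^bsub>E i\<^esub> \<in> carrier (E i)" if "i \<in> {1..m}" for i
  proof -
    interpret Ei: normed_space "E i" using E that .
    show ?thesis by simp
  qed
  then have z: "?z \<in> tuples m E"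
    by auto
  have top: "topspace ?P = tuples m E"
    using E by (auto simp: normed_space.topspace_vtopology PiE_iff)
  obtain U where U: "openin ?P U" "?z \<in> U" "\<forall>y\<in>U. vnorm F (A ?z \<ominus>\<^bsub>F\<^esub> A y) < 1"
    using cont z zero_less_one unfolding F.continuous_map_into_vtopology top by meson
  obtain V where V: "\<forall>i\<in>{1..m}. openin (vtopology (E i)) (V i)" "?z \<in> Pi\<^sub>E {1..m} V"
      "Pi\<^sub>E {1..m} V \<subseteq> U"
    using U(1,2) unfolding openin_product_topology_alt by meson
  have "\<exists>r>0. \<forall>x\<in>carrier (E i). vnorm (E i) x < r \<longrightarrow> x \<in> V i" if i: "i \<in> {1..m}" for i
  proof -
    interpret Ei: normed_space "E i" using E i .
    interpret D: Metric_space "carrier (E i)" "vdist (E i)"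
      by (rule Ei.Metric_space_vdist)
    have "\<zero>\<^bsub>E i\<^esub> \<in> V i"
      using V(2) i by (auto simp: PiE_iff)
    moreover have "openin D.mtopology (V i)"
      using V(1) i by (simp add: vtopology_def)
    ultimately obtain r where "r > 0" and r: "D.mball \<zero>\<^bsub>E i\<^esub> r \<subseteq> V i"
      unfolding D.openin_mtopology by blast
    have "x \<in> V i" if "x \<in> carrier (E i)" "vnorm (E i) x < r" for x
    proof -
      have "vdist (E i) \<zero>\<^bsub>E i\<^esub> x = vnorm (E i) x"
        using that by (simp add: vdist_def a_minus_def)
      then show ?thesis
        using r that by auto
    qed
    then show ?thesis
      using \<open>r > 0\<close> by blast
  qed
  then obtain r where r: "\<And>i. i \<in> {1..m} \<Longrightarrow> 0 < r i"
    "\<And>i x. i \<in> {1..m} \<Longrightarrow> x \<in> carrier (E i) \<Longrightarrow> vnorm (E i) x < r i \<Longrightarrow> x \<in> V i"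
    by metis
  (* Inserting 1 keeps the minimum meaningful for m = 0; halving makes the inequality strict. *)
  define \<delta> where "\<delta> = Min (insert 1 (r ` {1..m})) / 2"
  have "0 < \<delta>"
    using r(1) by (auto simp: \<delta>_def)
  have \<delta>_less: "\<delta> < r i" if "i \<in> {1..m}" for i
  proof -
    have "Min (insert 1 (r ` {1..m})) \<le> r i"
      using that by (intro Min_le) auto
    then show ?thesis
      using r(1)[OF that] by (simp add: \<delta>_def)
  qed
  have small: "vnorm F (A y) \<le> vnorm F (A ?z) + 1"
    if y: "y \<in> tuples m E" "\<forall>i\<in>{1..m}. vnorm (E i) (y i) \<le> \<delta>" for y
  proof -
    have "y i \<in> V i" if "i \<in> {1..m}" for i
      using r(2)[OF that PiE_mem[OF y(1) that]] \<delta>_less[OF that] y(2) that by fastforce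
    then have "y \<in> Pi\<^sub>E {1..m} V"
      using y(1) by (auto simp: PiE_def)
    then have *: "vnorm F (A ?z \<ominus>\<^bsub>F\<^esub> A y) < 1"
      using U(3) V(3) by blast
    have c: "A ?z \<in> carrier F" "A y \<in> carrier F"
      using Ax z y by auto
    then have "A y = A ?z \<oplus>\<^bsub>F\<^esub> \<ominus>\<^bsub>F\<^esub> (A ?z \<ominus>\<^bsub>F\<^esub> A y)"
      by (simp add: a_minus_def F.M.minus_add F.M.r_neg1 F.M.r_neg2)
    then have "vnorm F (A y) = vnorm F (A ?z \<oplus>\<^bsub>F\<^esub> \<ominus>\<^bsub>F\<^esub> (A ?z \<ominus>\<^bsub>F\<^esub> A y))"
      by simp
    also have "\<dots> \<le> vnorm F (A ?z) + vnorm F (\<ominus>\<^bsub>F\<^esub> (A ?z \<ominus>\<^bsub>F\<^esub> A y))"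
      using c by (intro F.vnorm_triangle) auto
    also have "\<dots> \<le> vnorm F (A ?z) + 1"
      using c * by simp
    finally show ?thesis .
  qed
  then show ?thesis
    using multilinear_op_scaled_bound[OF E F A \<open>0 < \<delta>\<close> zero_less_one small] by blast
qed

lemma slice_add:
  assumes "a \<in> tuples m E" "k \<in> {1..m}"
  shows "slice E (\<lambda>x\<in>tuples m E. A x \<oplus>\<^bsub>F\<^esub> B x) a k =
    (\<lambda>x\<in>carrier (E k). slice E A a k x \<oplus>\<^bsub>F\<^esub> slice E B a k x)"
  using tuples_update[OF assms] by (auto simp: slice_def intro!: restrict_ext)

lemma slice_smult:
  assumes "a \<in> tuples m E" "k \<in> {1..m}"
  shows "slice E (\<lambda>x\<in>tuples m E. c \<odot>\<^bsub>F\<^esub> A x) a k =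
    (\<lambda>x\<in>carrier (E k). c \<odot>\<^bsub>F\<^esub> slice E A a k x)"
  using tuples_update[OF assms] by (auto simp: slice_def intro!: restrict_ext)

lemma slice_zero:
  assumes "a \<in> tuples m E" "k \<in> {1..m}"
  shows "slice E (\<lambda>x\<in>tuples m E. \<zero>\<^bsub>F\<^esub>) a k = (\<lambda>x\<in>carrier (E k). \<zero>\<^bsub>F\<^esub>)"
  using tuples_update[OF assms] by (auto simp: slice_def intro!: restrict_ext)

lemma normed_space_continuous_multilinear_ops:
  fixes F :: "('k::real_normed_field, 'b) normed"
  assumes E: "\<And>i. i \<in> {1..m} \<Longrightarrow> normed_space (E i)" and F: "normed_space F"
  shows "normed_space (continuous_multilinear_ops m E F)"
proof -
  interpret F: normed_space F by fact
  let ?P = "product_topology (\<lambda>i. vtopology (E i)) {1..m}"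
  have top: "topspace ?P = tuples m E"
    using E by (auto simp: normed_space.topspace_vtopology PiE_iff)
  show ?thesis
    unfolding continuous_multilinear_ops_def
  proof (rule normed_space_op_space[OF F])
    let ?L = "{A \<in> extensional (tuples m E). multilinear_op m E F A \<and>
      continuous_map ?P (vtopology F) A}"
    let ?B = "{x \<in> tuples m E. \<forall>i\<in>{1..m}. vnorm (E i) (x i) \<le> 1}"
    show "?L \<subseteq> tuples m E \<rightarrow>\<^sub>E carrier F"
      by (auto simp: PiE_def multilinear_op_def)
    have mem: "A x \<in> carrier F" if "A \<in> ?L" "x \<in> tuples m E" for A x
      using that by (auto simp: multilinear_op_def)
    show "(\<lambda>x\<in>tuples m E. \<zero>\<^bsub>F\<^esub>) \<in> ?L"
    proof -
      have "multilinear_op m E F (\<lambda>x\<in>tuples m E. \<zero>\<^bsub>F\<^esub>)"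
        using linear_op_extensional_zero[OF E F] by (simp add: multilinear_op_def slice_zero del: One_nat_def)
      moreover have "continuous_map ?P (vtopology F) (\<lambda>x\<in>tuples m E. \<zero>\<^bsub>F\<^esub>)"
        by (rule continuous_map_eq[of _ _ "\<lambda>_. \<zero>\<^bsub>F\<^esub>"]) (simp_all only: top, simp_all)
      ultimately show ?thesis by simp
    qed
    show "(\<lambda>x\<in>tuples m E. A x \<oplus>\<^bsub>F\<^esub> B x) \<in> ?L" if AB: "A \<in> ?L" "B \<in> ?L" for A B
    proof -
      have "multilinear_op m E F (\<lambda>x\<in>tuples m E. A x \<oplus>\<^bsub>F\<^esub> B x)"
        using AB linear_op_extensional_add[OF E F] mem[OF AB(1)] mem[OF AB(2)]
        by (simp add: multilinear_op_def slice_add del: One_nat_def)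
      moreover have "continuous_map ?P (vtopology F) (\<lambda>x\<in>tuples m E. A x \<oplus>\<^bsub>F\<^esub> B x)"
        by (rule continuous_map_eq[OF F.continuous_map_add[of _ A B]]) (use AB top in auto)
      ultimately show ?thesis by simp
    qed
    show "(\<lambda>x\<in>tuples m E. c \<odot>\<^bsub>F\<^esub> A x) \<in> ?L" if A: "A \<in> ?L" for A c
    proof -
      have "multilinear_op m E F (\<lambda>x\<in>tuples m E. c \<odot>\<^bsub>F\<^esub> A x)"
        using A linear_op_extensional_smult[OF E F] mem[OF A]
        by (simp add: multilinear_op_def slice_smult del: One_nat_def)
      moreover have "continuous_map ?P (vtopology F) (\<lambda>x\<in>tuples m E. c \<odot>\<^bsub>F\<^esub> A x)"
        by (rule continuous_map_eq[OF F.continuous_map_smult[of _ A c]])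
          (use A top in auto)
      ultimately show ?thesis by simp
    qed
    have "\<zero>\<^bsub>E i\<^esub> \<in> carrier (E i) \<and> vnorm (E i) \<zero>\<^bsub>E i\<^esub> \<le> 1" if "i \<in> {1..m}" for i
    proof -
      interpret Ei: normed_space "E i" using E that .
      show ?thesis by simp
    qed
    then have "(\<lambda>i\<in>{1..m}. \<zero>\<^bsub>E i\<^esub>) \<in> ?B"
      by auto
    then show "?B \<noteq> {}"
      by blast
    show "\<exists>K. \<forall>x\<in>?B. vnorm F (A x) \<le> K" if "A \<in> ?L" for A
    proof -
      have "\<exists>K. \<forall>x\<in>tuples m E. (\<forall>i\<in>{1..m}. vnorm (E i) (x i) \<le> 1) \<longrightarrow> vnorm F (A x) \<le> K"
        using that by (intro continuous_multilinear_op_bounded[OF E F]) auto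
      then show ?thesis
        by blast
    qed
    show "A x = \<zero>\<^bsub>F\<^esub>" if A: "A \<in> ?L" and 0: "\<forall>x\<in>?B. A x = \<zero>\<^bsub>F\<^esub>" and x: "x \<in> tuples m E" for A x
    proof -
      have Ax: "A x \<in> carrier F"
        using mem A x .
      have nonneg: "0 \<le> vnorm (E i) (x i)" if "i \<in> {1..m}" for i
        using normed_space.vnorm_nonneg[OF E[OF that]] PiE_mem[OF x that] .
      define R where "R = 1 + (\<Sum>i\<in>{1..m}. vnorm (E i) (x i))"
      have "0 < R"
        using sum_nonneg[of "{1..m}" "\<lambda>i. vnorm (E i) (x i)"] nonneg by (simp add: R_def)
      moreover have "vnorm (E i) (x i) \<le> R" if "i \<in> {1..m}" for i
        using member_le_sum[of i "{1..m}" "\<lambda>i. vnorm (E i) (x i)"] nonneg that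
        by (simp add: R_def)
      ultimately have "vnorm F (A x) \<le> (R / 1) ^ m * 0"
        using A x 0 by (intro multilinear_op_scaled_bound[OF E F, of m]) auto
      then show ?thesis
        using F.vnorm_nonneg[OF Ax] F.vnorm_eq_0_iff[OF Ax] by simp
    qed
  qed auto
qed

section \<open>Slicing is a bounded linear map\<close>

text \<open>
  A real supremum bounds the values only when it is finite; here that is the boundedness of
  continuous multilinear operators.
\<close>

lemma vnorm_le_sup_norm:
  assumes E: "\<And>i. i \<in> {1..m} \<Longrightarrow> normed_space (E i)" and F: "normed_space F"
    and A: "A \<in> carrier (continuous_multilinear_ops m E F)"
    and x: "x \<in> tuples m E" "\<forall>i\<in>{1..m}. vnorm (E i) (x i) \<le> 1"
  shows "vnorm F (A x) \<le> vnorm (continuous_multilinear_ops m E F) A"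
proof -
  have "\<exists>K. \<forall>x\<in>tuples m E. (\<forall>i\<in>{1..m}. vnorm (E i) (x i) \<le> 1) \<longrightarrow> vnorm F (A x) \<le> K"
    using A by (intro continuous_multilinear_op_bounded[OF E F])
      (auto simp: continuous_multilinear_ops_def)
  then show ?thesis
    unfolding continuous_multilinear_ops_def op_space_simps
    using x by (intro cSUP_upper) (auto simp: bdd_above_def)
qed

text \<open>
  The constant depends on \<open>a\<close> but not on \<open>A\<close>: all entries of \<open>a(k := x)\<close> with \<open>x\<close> in the unit
  ball are bounded by \<open>R = 1 + (\<Sum>i\<in>{1..m}. vnorm (E i) (a i))\<close>.
\<close>

lemma slice_vnorm_le:
  assumes E: "\<And>i. i \<in> {1..m} \<Longrightarrow> normed_space (E i)" and F: "normed_space F"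
    and k: "k \<in> {1..m}" and a: "a \<in> tuples m E"
  obtains K where "\<And>A x. A \<in> carrier (continuous_multilinear_ops m E F) \<Longrightarrow> x \<in> carrier (E k) \<Longrightarrow>
    vnorm (E k) x \<le> 1 \<Longrightarrow>
    vnorm F (slice E A a k x) \<le> K * vnorm (continuous_multilinear_ops m E F) A"
proof
  have nonneg: "0 \<le> vnorm (E i) (a i)" if "i \<in> {1..m}" for i
    using normed_space.vnorm_nonneg[OF E[OF that]] PiE_mem[OF a that] .
  define R where "R = 1 + (\<Sum>i\<in>{1..m}. vnorm (E i) (a i))"
  have R: "1 \<le> R"
    using sum_nonneg[of "{1..m}" "\<lambda>i. vnorm (E i) (a i)"] nonneg by (simp add: R_def)
  have aR: "vnorm (E i) (a i) \<le> R" if "i \<in> {1..m}" for i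
    using member_le_sum[of i "{1..m}" "\<lambda>i. vnorm (E i) (a i)"] nonneg that
    by (simp add: R_def)
  fix A x assume A: "A \<in> carrier (continuous_multilinear_ops m E F)"
    and x: "x \<in> carrier (E k)" "vnorm (E k) x \<le> 1"
  have "vnorm F (A (a(k := x))) \<le> (R / 1) ^ m * vnorm (continuous_multilinear_ops m E F) A"
  proof (rule multilinear_op_scaled_bound[OF E F])
    show "multilinear_op m E F A"
      using A by (simp add: continuous_multilinear_ops_def)
    show "a(k := x) \<in> tuples m E"
      using tuples_update[OF a k x(1)] .
    show "\<forall>i\<in>{1..m}. vnorm (E i) ((a(k := x)) i) \<le> R"
      using aR x R by auto
  qed (use R vnorm_le_sup_norm[OF E F A] in auto)
  then show "vnorm F (slice E A a k x) \<le> R ^ m * vnorm (continuous_multilinear_ops m E F) A"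
    using x by (simp add: slice_def)
qed

lemma slice_in_bounded_linear_ops:
  assumes E: "\<And>i. i \<in> {1..m} \<Longrightarrow> normed_space (E i)" and F: "normed_space F"
    and k: "k \<in> {1..m}" and a: "a \<in> tuples m E"
    and A: "A \<in> carrier (continuous_multilinear_ops m E F)"
  shows "slice E A a k \<in> carrier (bounded_linear_ops (E k) F)"
proof -
  have lin: "linear_op (E k) F (slice E A a k)"
    using A k a by (auto simp: continuous_multilinear_ops_def multilinear_op_def)
  obtain K where K: "\<And>x. x \<in> carrier (E k) \<Longrightarrow> vnorm (E k) x \<le> 1 \<Longrightarrow>
      vnorm F (slice E A a k x) \<le> K * vnorm (continuous_multilinear_ops m E F) A"
    using slice_vnorm_le[OF E F k a] A by metis
  have "vnorm F (slice E A a k x) \<le>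
      (K * vnorm (continuous_multilinear_ops m E F) A) * vnorm (E k) x" if "x \<in> carrier (E k)" for x
    using K that by (intro linear_op_unit_ball_bound[OF E[OF k] F lin]) auto
  then show ?thesis
    using lin by (auto simp: bounded_linear_ops_def slice_def)
qed

lemma linear_op_slice:
  assumes E: "\<And>i. i \<in> {1..m} \<Longrightarrow> normed_space (E i)" and F: "normed_space F"
    and k: "k \<in> {1..m}" and a: "a \<in> tuples m E"
  shows "linear_op (continuous_multilinear_ops m E F) (bounded_linear_ops (E k) F)
    (\<lambda>A. slice E A a k)"
  using slice_in_bounded_linear_ops[OF E F k a]
  by (auto simp: linear_op_def continuous_multilinear_ops_def bounded_linear_ops_def
      slice_add[OF a k] slice_smult[OF a k]
      simp del: One_nat_def)

lemma bounded_slice: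
  assumes E: "\<And>i. i \<in> {1..m} \<Longrightarrow> normed_space (E i)" and F: "normed_space F"
    and k: "k \<in> {1..m}" and a: "a \<in> tuples m E"
  obtains K where "\<And>A. A \<in> carrier (continuous_multilinear_ops m E F) \<Longrightarrow>
    vnorm (bounded_linear_ops (E k) F) (slice E A a k)
      \<le> K * vnorm (continuous_multilinear_ops m E F) A"
proof -
  interpret Ek: normed_space "E k" using E k .
  obtain K where K: "\<And>A x. A \<in> carrier (continuous_multilinear_ops m E F) \<Longrightarrow> x \<in> carrier (E k) \<Longrightarrow>
    vnorm (E k) x \<le> 1 \<Longrightarrow>
    vnorm F (slice E A a k x) \<le> K * vnorm (continuous_multilinear_ops m E F) A"
    using slice_vnorm_le[OF E F k a] by metis
  have "\<zero>\<^bsub>E k\<^esub> \<in> {x \<in> carrier (E k). vnorm (E k) x \<le> 1}"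
    by simp
  then have "{x \<in> carrier (E k). vnorm (E k) x \<le> 1} \<noteq> {}"
    by blast
  then show thesis
    using K by (intro that[of K]) (auto simp: bounded_linear_ops_def intro!: cSUP_least)
qed

theorem proposition5p1:
  fixes C :: "('k::real_normed_field, 'a) normed set"
    and F :: "('k, 'b) normed"
    and P :: "('k, 'a) normed \<Rightarrow> ('a \<Rightarrow> 'b) \<Rightarrow> bool"
  assumes "\<And>E. E \<in> C \<Longrightarrow> banach_space E"
    and "banach_space F"
    and "\<And>E. E \<in> C \<Longrightarrow>
      closed_subspace {u \<in> carrier (bounded_linear_ops E F). P E u} (bounded_linear_ops E F)"
  shows "\<forall>m\<ge>1. \<forall>E :: nat \<Rightarrow> ('k, 'a) normed. (\<forall>i\<in>{1..m}. E i \<in> C) \<longrightarrow>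
    closed_subspace {A \<in> carrier (continuous_multilinear_ops m E F). has_separately P m E A}
      (continuous_multilinear_ops m E F)"
proof (intro allI impI)
  fix m :: nat and E :: "nat \<Rightarrow> ('k, 'a) normed"
  assume m: "1 \<le> m" and EC: "\<forall>i\<in>{1..m}. E i \<in> C"
  have E: "normed_space (E i)" if "i \<in> {1..m}" for i
    using assms(1) EC that by (auto simp: banach_space_def)
  have F: "normed_space F"
    using assms(2) by (simp add: banach_space_def)
  let ?X = "continuous_multilinear_ops m E F"
  let ?I = "{1..m} \<times> tuples m E"
  let ?G = "\<lambda>k. {u \<in> carrier (bounded_linear_ops (E k) F). P (E k) u}"
  let ?S = "\<lambda>(k, a). {A \<in> carrier ?X. slice E A a k \<in> ?G k}"
  have X: "normed_space ?X"
    using normed_space_continuous_multilinear_ops[OF E F] .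
  have "\<zero>\<^bsub>E i\<^esub> \<in> carrier (E i)" if "i \<in> {1..m}" for i
  proof -
    interpret Ei: normed_space "E i" using E that .
    show ?thesis by simp
  qed
  then have "(1, \<lambda>i\<in>{1..m}. \<zero>\<^bsub>E i\<^esub>) \<in> ?I"
    using m by auto
  (* With an empty index set the intersection below would be the whole type, not a subspace. *)
  then have ne: "?I \<noteq> {}"
    by blast
  have "closed_subspace (?S p) ?X" if p: "p \<in> ?I" for p
  proof -
    obtain k a where ka: "p = (k, a)" "k \<in> {1..m}" "a \<in> tuples m E"
      using p by auto
    obtain K where K: "\<And>A. A \<in> carrier ?X \<Longrightarrow>
        vnorm (bounded_linear_ops (E k) F) (slice E A a k) \<le> K * vnorm ?X A"
      using bounded_slice[OF E F ka(2,3)] by metis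
    have "closed_subspace {A \<in> carrier ?X. slice E A a k \<in> ?G k} ?X"
    proof (rule closed_subspace_vimage[OF X])
      show "normed_space (bounded_linear_ops (E k) F)"
        using normed_space_bounded_linear_ops[OF E[OF ka(2)] F] .
      show "linear_op ?X (bounded_linear_ops (E k) F) (\<lambda>A. slice E A a k)"
        using linear_op_slice[OF E F ka(2,3)] .
      show "closed_subspace (?G k) (bounded_linear_ops (E k) F)"
        using assms(3) EC ka(2) by blast
    qed (rule K)
    then show ?thesis
      using ka(1) by simp
  qed
  then have "closed_subspace (\<Inter>p\<in>?I. ?S p) ?X"
    by (rule closed_subspace_INT[OF X ne])
  moreover have "(\<Inter>p\<in>?I. ?S p) = {A \<in> carrier ?X. has_separately P m E A}"
  proof
    show "(\<Inter>p\<in>?I. ?S p) \<subseteq> {A \<in> carrier ?X. has_separately P m E A}"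
      using ne by (fastforce simp: has_separately_def)
    show "{A \<in> carrier ?X. has_separately P m E A} \<subseteq> (\<Inter>p\<in>?I. ?S p)"
    proof
      fix A assume A: "A \<in> {A \<in> carrier ?X. has_separately P m E A}"
      have "slice E A a k \<in> ?G k" if "k \<in> {1..m}" "a \<in> tuples m E" for k a
        using slice_in_bounded_linear_ops[OF E F that] A that by (simp add: has_separately_def)
      then show "A \<in> (\<Inter>p\<in>?I. ?S p)"
        using A by blast
    qed
  qed
  ultimately show "closed_subspace {A \<in> carrier ?X. has_separately P m E A} ?X"
    by simp
qed

end
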